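(* Let $\Delta$ be an edge-reflecting convex polytope embedded in the $n$-dimensional real vector space $\mathfrak g^*$ by $\Phi$, and assume that there is a lattice in $\mathfrak g^*$ such that the edges of $\Delta$ are scalar multiples of rational vectors. Let $(\Gamma,\alpha)$ be the GKM one-skeleton of $\Delta$. Then the space of rational deformations of $\Phi$ is $H^2(\Gamma,\alpha)$; that is, a function $f:V_\Gamma\to\mathfrak g^*$ is a rational deformation of $\Phi$ if and only if $f\in H^2(\Gamma,\alpha)$.
   Context: $\Gamma$ is the graph of vertices $V_\Gamma$ and edges of the polytope $\Delta$; $\Phi(p)\in\mathfrak g^*$ denotes the position of the vertex $p$. For an oriented edge from $p$ to $q$, the axial function is $\alpha_{pq}=\Phi(q)-\Phi(p)$. The pair $(\Gamma,\alpha)$ is the GKM one-skeleton of $\Delta$. Edge-reflecting: if two vertices $p$ and $q$ are joined by an edge $e$ of $\Delta$, then for every edge $e'\ne e$ containing $p$ there exists a unique edge $e''\neq e$ containing $q$ such that $e,e',e''$ are coplanar. $H^2(\Gamma,\alpha)$ is the space of maps $f:V_\Gamma\to\mathfrak g^*$ such that $f(q)-f(p)\in\mathbb R\,\alpha_{pq}$ for every edge $(p,q)$ of $\Gamma$. A function $f:V_\Gamma\to\mathfrak g^*$ is a rational deformation of $\Phi$ if there exists $\epsilon>0$ such that for every $t\in[0,\epsilon)$ the map $\Phi_t:V_\Gamma\to\mathfrak g^*$, $\Phi_t(p)=\Phi(p)+tf(p)$, is an embedding (is injective) and, for every oriented edge $pq$ of $\Gamma$, $\Phi_t(q)-\Phi_t(p)$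 is a positive multiple of $\alpha_{pq}$. *)

theory Defs
  imports "HOL-Analysis.Analysis"
begin

text \<open>
  The vertices of a polytope \<open>\<Delta>\<close> are labelled by an abstract set \<open>V\<close>; the map \<open>\<Phi>\<close> gives their
  positions. The ambient vector space is a Euclidean space, so edges are \<^const>\<open>edge_of\<close> and
  vertices are points satisfying \<^const>\<open>extreme_point_of\<close>.
\<close>

definition embedded_polytope :: "'v set \<Rightarrow> ('v \<Rightarrow> 'a::euclidean_space) \<Rightarrow> 'a set \<Rightarrow> bool" where
  "embedded_polytope V \<Phi> \<Delta> \<longleftrightarrow>
     polytope \<Delta> \<and> bij_betw \<Phi> V {x. x extreme_point_of \<Delta>}"

text \<open>Each edge gives rise to both of its orientations.\<close>

definition oriented_edges ::
    "'v set \<Rightarrow> ('v \<Rightarrow> 'a::euclidean_space) \<Rightarrow> 'a set \<Rightarrow> ('v \<times> 'v) set" where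
  "oriented_edges V \<Phi> \<Delta> =
     {(p, q). p \<in> V \<and> q \<in> V \<and> closed_segment (\<Phi> p) (\<Phi> q) edge_of \<Delta>}"

definition axial :: "('v \<Rightarrow> 'a::euclidean_space) \<Rightarrow> 'v \<Rightarrow> 'v \<Rightarrow> 'a" where
  "axial \<Phi> p q = \<Phi> q - \<Phi> p"

definition edge_reflecting :: "'a::euclidean_space set \<Rightarrow> bool" where
  "edge_reflecting \<Delta> \<longleftrightarrow>
     (\<forall>x y e. x extreme_point_of \<Delta> \<and> y extreme_point_of \<Delta> \<and> x \<noteq> y \<and>
              e edge_of \<Delta> \<and> x \<in> e \<and> y \<in> e \<longrightarrow>
        (\<forall>e'. e' edge_of \<Delta> \<and> e' \<noteq> e \<and> x \<in> e' \<longrightarrow>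
           (\<exists>!e''. e'' edge_of \<Delta> \<and> e'' \<noteq> e \<and> y \<in> e'' \<and> coplanar (e \<union> e' \<union> e''))))"

text \<open>A lattice is the group of integer combinations of a basis of the whole space.\<close>

definition is_lattice :: "'a::euclidean_space set \<Rightarrow> bool" where
  "is_lattice L \<longleftrightarrow>
     (\<exists>B. independent B \<and> span B = UNIV \<and>
          L = {\<Sum>b\<in>B. of_int (k b) *\<^sub>R b | k :: 'a \<Rightarrow> int. True})"

text \<open>The rational vectors for \<open>L\<close> are the elements of its rational span, that is, the vectors with
  a nonzero integer multiple in \<open>L\<close>.\<close>

definition rational_vector :: "'a::euclidean_space set \<Rightarrow> 'a \<Rightarrow> bool" where
  "rational_vector L v \<longleftrightarrow> (\<exists>m::int. m \<noteq> 0 \<and> of_int m *\<^sub>R v \<in> L)"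

text \<open>Maps on \<open>V\<close> are represented as elements of \<open>V \<rightarrow>\<^sub>E UNIV\<close>, so that a map is determined by its
  values on \<open>V\<close>.\<close>

definition GKM_H2 ::
    "'v set \<Rightarrow> ('v \<times> 'v) set \<Rightarrow> ('v \<Rightarrow> 'v \<Rightarrow> 'a::real_vector) \<Rightarrow> ('v \<Rightarrow> 'a) set" where
  "GKM_H2 V E \<alpha> =
     {f \<in> V \<rightarrow>\<^sub>E UNIV. \<forall>(p, q)\<in>E. \<exists>c::real. f q - f p = c *\<^sub>R \<alpha> p q}"

definition rational_deformations ::
    "'v set \<Rightarrow> ('v \<times> 'v) set \<Rightarrow> ('v \<Rightarrow> 'v \<Rightarrow> 'a::real_vector) \<Rightarrow> ('v \<Rightarrow> 'a) \<Rightarrow> ('v \<Rightarrow> 'a) set" where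
  "rational_deformations V E \<alpha> \<Phi> =
     {f \<in> V \<rightarrow>\<^sub>E UNIV. \<exists>\<epsilon>>0. \<forall>t\<in>{0..<\<epsilon>::real}.
        inj_on (\<lambda>p. \<Phi> p + t *\<^sub>R f p) V \<and>
        (\<forall>(p, q)\<in>E. \<exists>c>0. (\<Phi> q + t *\<^sub>R f q) - (\<Phi> p + t *\<^sub>R f p) = c *\<^sub>R \<alpha> p q)}"

end

theory Submission
  imports Defs
begin

text \<open>
  Moving the vertices along \<open>f \<in> H\<^sup>2\<close> multiplies the edge vector \<open>\<alpha>\<^sub>p\<^sub>q\<close> by \<open>1 + tc\<close>, which is
  positive for small \<open>t\<close>; distinct vertices also stay distinct for small \<open>t\<close>. Both are finitely many
  open conditions that hold at \<open>t = 0\<close>. Conversely, subtracting \<open>\<alpha>\<^sub>p\<^sub>q\<close> from the edge vector at a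
  single time \<open>t > 0\<close> shows that \<open>f q - f p\<close> is a multiple of \<open>\<alpha>\<^sub>p\<^sub>q\<close>.
\<close>

lemma rational_deformations_subset_GKM_H2:
  "rational_deformations V E (axial \<Phi>) \<Phi> \<subseteq> GKM_H2 V E (axial \<Phi>)"
proof
  fix f assume f: "f \<in> rational_deformations V E (axial \<Phi>) \<Phi>"
  then obtain \<epsilon> :: real where "\<epsilon> > 0" and
    defm: "\<And>t p q. \<lbrakk>t \<in> {0..<\<epsilon>}; (p, q) \<in> E\<rbrakk> \<Longrightarrow>
      \<exists>c>0. (\<Phi> q + t *\<^sub>R f q) - (\<Phi> p + t *\<^sub>R f p) = c *\<^sub>R axial \<Phi> p q"
    unfolding rational_deformations_def by fast
  \<comment> \<open>Any fixed time strictly inside the interval serves; \<open>t = 0\<close> says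
    nothing about \<open>f\<close>, and \<open>t\<close> is divided by below.\<close>
  define t where "t = \<epsilon> / 2"
  have t: "t \<in> {0..<\<epsilon>}" "t > 0" using \<open>\<epsilon> > 0\<close> by (auto simp: t_def)
  have "\<exists>c. f q - f p = c *\<^sub>R axial \<Phi> p q" if pq: "(p, q) \<in> E" for p q
  proof -
    obtain c where "(\<Phi> q + t *\<^sub>R f q) - (\<Phi> p + t *\<^sub>R f p) = c *\<^sub>R axial \<Phi> p q"
      using defm[OF t(1) pq] by blast
    \<comment> \<open>The edge vector at time \<open>t\<close> is
      \<open>axial \<Phi> p q + t *\<^sub>R (f q - f p)\<close>, hence the coefficient
      \<open>c - 1\<close>.\<close>
    then have "t *\<^sub>R (f q - f p) = (c - 1) *\<^sub>R axial \<Phi> p q"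
      by (simp add: axial_def algebra_simps)
    then have "f q - f p = ((c - 1) / t) *\<^sub>R axial \<Phi> p q"
      using t(2) by (simp add: vector_fraction_eq_iff eq_vector_fraction_iff)
    then show ?thesis ..
  qed
  with f show "f \<in> GKM_H2 V E (axial \<Phi>)"
    unfolding rational_deformations_def GKM_H2_def by auto
qed

text \<open>Phrasing each condition as \<open>eventually\<close> in \<open>nhds 0\<close> avoids
  explicit thresholds: finiteness of \<open>V\<close> and \<open>E\<close> merges them into one
  neighbourhood, from which \<epsilon> is read off.\<close>

lemma GKM_H2_subset_rational_deformations:
  fixes \<Phi> :: "'v \<Rightarrow> 'a::euclidean_space"
  assumes "finite V" and "finite E" and inj: "inj_on \<Phi> V"
  shows "GKM_H2 V E (axial \<Phi>) \<subseteq> rational_deformations V E (axial \<Phi>) \<Phi>"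
proof
  fix f assume f: "f \<in> GKM_H2 V E (axial \<Phi>)"
  have "\<forall>\<^sub>F t in nhds (0::real). \<Phi> p + t *\<^sub>R f p \<noteq> \<Phi> q + t *\<^sub>R f q"
    if "p \<in> V" "q \<in> V" "p \<noteq> q" for p q
  proof -
    \<comment> \<open>The difference of two moved vertices is continuous in \<open>t\<close> and
      nonzero at \<open>0\<close> by injectivity of \<open>\<Phi>\<close>, so it stays nonzero
      nearby.\<close>
    have "((\<lambda>t. (\<Phi> p + t *\<^sub>R f p) - (\<Phi> q + t *\<^sub>R f q)) \<longlongrightarrow>
        (\<Phi> p + 0 *\<^sub>R f p) - (\<Phi> q + 0 *\<^sub>R f q)) (nhds (0::real))"
      by (intro tendsto_intros filterlim_ident)
    moreover have "(\<Phi> p + 0 *\<^sub>R f p) - (\<Phi> q + 0 *\<^sub>R f q) \<noteq> 0"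
      using inj that by (auto dest: inj_onD)
    ultimately have "\<forall>\<^sub>F t in nhds (0::real). (\<Phi> p + t *\<^sub>R f p) - (\<Phi> q + t *\<^sub>R f q) \<noteq> 0"
      by (rule tendsto_imp_eventually_ne)
    then show ?thesis by simp
  qed
  then have "\<forall>\<^sub>F t in nhds (0::real).
      \<forall>p\<in>V. \<forall>q\<in>V. p \<noteq> q \<longrightarrow> \<Phi> p + t *\<^sub>R f p \<noteq> \<Phi> q + t *\<^sub>R f q"
    using \<open>finite V\<close> by (intro eventually_ball_finite ballI) (auto intro: always_eventually)
  then have inj_near: "\<forall>\<^sub>F t in nhds (0::real). inj_on (\<lambda>p. \<Phi> p + t *\<^sub>R f p) V"
    by (rule eventually_mono) (auto simp: inj_on_def)
  have "\<forall>\<^sub>F t in nhds (0::real).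
      \<exists>c>0. (\<Phi> q + t *\<^sub>R f q) - (\<Phi> p + t *\<^sub>R f p) = c *\<^sub>R axial \<Phi> p q"
    if pq: "(p, q) \<in> E" for p q
  proof -
    obtain c where c: "f q - f p = c *\<^sub>R axial \<Phi> p q"
      using f pq by (fastforce simp: GKM_H2_def)
    \<comment> \<open>\<open>1 + t * c\<close> is the stretching factor of the edge;
      \<open>c\<close> may have either sign, so positivity comes from the limit \<open>1\<close> at
      \<open>0\<close>.\<close>
    have "((\<lambda>t. 1 + t * c) \<longlongrightarrow> 1 + 0 * c) (nhds (0::real))"
      by (intro tendsto_intros filterlim_ident)
    then have "\<forall>\<^sub>F t in nhds (0::real). 0 < 1 + t * c"
      by (rule order_tendstoD(1)) simp
    then show ?thesis
    proof (rule eventually_mono)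
      fix t :: real assume "0 < 1 + t * c"
      moreover have "(\<Phi> q + t *\<^sub>R f q) - (\<Phi> p + t *\<^sub>R f p) = axial \<Phi> p q + t *\<^sub>R (f q - f p)"
        by (simp add: axial_def algebra_simps)
      then have "(\<Phi> q + t *\<^sub>R f q) - (\<Phi> p + t *\<^sub>R f p) = (1 + t * c) *\<^sub>R axial \<Phi> p q"
        by (simp add: c scaleR_add_left)
      ultimately show "\<exists>c>0. (\<Phi> q + t *\<^sub>R f q) - (\<Phi> p + t *\<^sub>R f p) = c *\<^sub>R axial \<Phi> p q"
        by blast
    qed
  qed
  then have "\<forall>\<^sub>F t in nhds (0::real). \<forall>(p, q)\<in>E.
      \<exists>c>0. (\<Phi> q + t *\<^sub>R f q) - (\<Phi> p + t *\<^sub>R f p) = c *\<^sub>R axial \<Phi> p q"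
    using \<open>finite E\<close> by (intro eventually_ball_finite ballI) auto
  with inj_near have "\<forall>\<^sub>F t in nhds (0::real). inj_on (\<lambda>p. \<Phi> p + t *\<^sub>R f p) V \<and>
      (\<forall>(p, q)\<in>E. \<exists>c>0. (\<Phi> q + t *\<^sub>R f q) - (\<Phi> p + t *\<^sub>R f p) = c *\<^sub>R axial \<Phi> p q)"
    by (rule eventually_conj)
  \<comment> \<open>\<open>nhds 0\<close> is not punctured, so the ball of radius \<epsilon> covers
    all of \<open>{0..<\<epsilon>}\<close>, with \<open>t = 0\<close> included.\<close>
  then obtain \<epsilon> where "\<epsilon> > 0" and "\<forall>t. dist t 0 < \<epsilon> \<longrightarrow> inj_on (\<lambda>p. \<Phi> p + t *\<^sub>R f p) V \<and>
      (\<forall>(p, q)\<in>E. \<exists>c>0. (\<Phi> q + t *\<^sub>R f q) - (\<Phi> p + t *\<^sub>R f p) = c *\<^sub>R axial \<Phi> p q)"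
    unfolding eventually_nhds_metric by blast
  moreover have "dist t 0 < \<epsilon>" if "t \<in> {0..<\<epsilon>}" for t :: real
    using that by simp
  ultimately have "\<exists>\<epsilon>>0. \<forall>t\<in>{0..<\<epsilon>::real}. inj_on (\<lambda>p. \<Phi> p + t *\<^sub>R f p) V \<and>
      (\<forall>(p, q)\<in>E. \<exists>c>0. (\<Phi> q + t *\<^sub>R f q) - (\<Phi> p + t *\<^sub>R f p) = c *\<^sub>R axial \<Phi> p q)"
    by blast
  with f show "f \<in> rational_deformations V E (axial \<Phi>) \<Phi>"
    by (simp add: rational_deformations_def GKM_H2_def)
qed

theorem theorem3p2p1:
  fixes \<Delta> :: "'a::euclidean_space set"
    and V :: "'v set"
    and \<Phi> :: "'v \<Rightarrow> 'a"
  assumes "embedded_polytope V \<Phi> \<Delta>"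
    and "edge_reflecting \<Delta>"
    and "\<exists>L. is_lattice L \<and>
           (\<forall>(p, q)\<in>oriented_edges V \<Phi> \<Delta>.
              \<exists>(c::real) v. rational_vector L v \<and> \<Phi> q - \<Phi> p = c *\<^sub>R v)"
  shows "rational_deformations V (oriented_edges V \<Phi> \<Delta>) (axial \<Phi>) \<Phi>
       = GKM_H2 V (oriented_edges V \<Phi> \<Delta>) (axial \<Phi>)"
proof (rule subset_antisym)
  \<comment> \<open>A polytope has finitely many extreme points, and the bijection carries this over
    to \<open>V\<close>; the oriented edges are then finite as a subset of
    \<open>V \<times> V\<close>.\<close>
  have "bij_betw \<Phi> V {x. x extreme_point_of \<Delta>}" "finite {x. x extreme_point_of \<Delta>}"
    using assms(1) finite_polyhedron_extreme_points polytope_imp_polyhedron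
    unfolding embedded_polytope_def by blast+
  then have "finite V" "inj_on \<Phi> V"
    by (auto simp: bij_betw_finite bij_betw_def)
  moreover from \<open>finite V\<close> have "finite (oriented_edges V \<Phi> \<Delta>)"
    by (auto intro: finite_subset[of _ "V \<times> V"] simp: oriented_edges_def)
  ultimately show "GKM_H2 V (oriented_edges V \<Phi> \<Delta>) (axial \<Phi>)
      \<subseteq> rational_deformations V (oriented_edges V \<Phi> \<Delta>) (axial \<Phi>) \<Phi>"
    by (intro GKM_H2_subset_rational_deformations)
qed (rule rational_deformations_subset_GKM_H2)

end
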